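(* The following hold for hypercubes. (a) $\rho_2(Q_n)=2^{\,n-\lfloor\log_2 n\rfloor-1}$ for every integer $n$ with $2\le n\le 7$ and for every $n=2^k-1$ with $k\ge 2$ an integer. (b) $\rho^{\rm o}(Q_n)=2^{\,n-\lfloor\log_2 (n-1)\rfloor-1}$ for every integer $n$ with $2\le n\le 8$ and for every $n=2^k$ with $k\ge 1$ an integer. (c) $\rho_2(Q_8)\ge 17$ and $\rho^{\rm o}(Q_9)\ge 34$; in particular, the equality in (a) fails for $n=8$ and the equality in (b) fails for $n=9$.
   Context: For a vertex $x$ of a graph $G$, $N(x)$ is the set of vertices adjacent to $x$ and $N[x]=N(x)\cup\{x\}$. A set $X\subseteq V(G)$ is a $2$-packing of $G$ if $N[x]\cap N[y]=\emptyset$ for every pair of distinct $x,y\in X$; $\rho_2(G)$ is the maximum cardinality of a $2$-packing of $G$. A set $X\subseteq V(G)$ is an open packing of $G$ if $N(x)\cap N(y)=\emptyset$ for every pair of distinct $x,y\in X$ (two vertices of an open packing may be adjacent); $\rho^{\rm o}(G)$ is the maximum cardinality of an open packing of $G$. $Q_n$ is the $n$-dimensional hypercube: its vertices are the binary strings of length $n$, and two are adjacent if they differ in exactly one coordinate. *)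

theory Defs
  imports "HOL-Analysis.Analysis" "Graph_Theory.Pair_Digraph"
begin

text \<open>
  A finite simple graph is a \<^locale>\<open>pair_graph\<close>: the arc set is a finite, symmetric,
  irreflexive relation on the finite vertex set.
\<close>

definition nbh :: "'a pair_pre_digraph \<Rightarrow> 'a \<Rightarrow> 'a set" where
  "nbh G x = {y \<in> pverts G. (x, y) \<in> parcs G}"

definition closed_nbh :: "'a pair_pre_digraph \<Rightarrow> 'a \<Rightarrow> 'a set" where
  "closed_nbh G x = nbh G x \<union> {x}"

definition two_packing :: "'a pair_pre_digraph \<Rightarrow> 'a set \<Rightarrow> bool" where
  "two_packing G X \<longleftrightarrow> X \<subseteq> pverts G \<and>
     (\<forall>x\<in>X. \<forall>y\<in>X. x \<noteq> y \<longrightarrow> closed_nbh G x \<inter> closed_nbh G y = {})"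

definition open_packing :: "'a pair_pre_digraph \<Rightarrow> 'a set \<Rightarrow> bool" where
  "open_packing G X \<longleftrightarrow> X \<subseteq> pverts G \<and>
     (\<forall>x\<in>X. \<forall>y\<in>X. x \<noteq> y \<longrightarrow> nbh G x \<inter> nbh G y = {})"

text \<open>
  The maxima below are meaningful for graphs with a finite vertex set, where the sets of
  cardinalities are finite and, because of the empty packing, nonempty.
\<close>

definition packing_number :: "'a pair_pre_digraph \<Rightarrow> nat" where
  "packing_number G = Max {card X | X. two_packing G X}"

definition open_packing_number :: "'a pair_pre_digraph \<Rightarrow> nat" where
  "open_packing_number G = Max {card X | X. open_packing G X}"

definition hypercube :: "nat \<Rightarrow> bool list pair_pre_digraph" where
  "hypercube n =
     \<lparr> pverts = {xs. length xs = n},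
       parcs = {(xs, ys). length xs = n \<and> length ys = n \<and>
                          card {i. i < n \<and> xs ! i \<noteq> ys ! i} = 1} \<rparr>"

lemma packing_cards:
  assumes "finite (pverts G)"
  shows "finite {card X | X. two_packing G X}" "{card X | X. two_packing G X} \<noteq> {}"
    and "finite {card X | X. open_packing G X}" "{card X | X. open_packing G X} \<noteq> {}"
proof -
  have "{card X | X. two_packing G X} \<subseteq> card ` Pow (pverts G)"
    "{card X | X. open_packing G X} \<subseteq> card ` Pow (pverts G)"
    by (auto simp: two_packing_def open_packing_def)
  then show "finite {card X | X. two_packing G X}" "finite {card X | X. open_packing G X}"
    using assms by (meson finite_Pow_iff finite_imageI finite_subset)+
  have "two_packing G {}" "open_packing G {}"
    by (simp_all add: two_packing_def open_packing_def)
  then show "{card X | X. two_packing G X} \<noteq> {}" "{card X | X. open_packing G X} \<noteq> {}"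
    by blast+
qed

lemma pair_graph_hypercube: "pair_graph (hypercube n)"
proof -
  have fin: "finite {xs :: bool list. length xs = n}"
    using finite_lists_length_eq[of "UNIV :: bool set" n] by simp
  have "parcs (hypercube n) \<subseteq> {xs. length xs = n} \<times> {xs. length xs = n}"
    by (auto simp: hypercube_def)
  then have fin_arcs: "finite (parcs (hypercube n))"
    by (rule finite_subset) (use fin in simp)
  have sym: "symmetric (with_proj (hypercube n))"
  proof -
    have comm: "{i. i < n \<and> xs ! i \<noteq> ys ! i} = {i. i < n \<and> ys ! i \<noteq> xs ! i}"
      for xs ys :: "bool list"
      by blast
    have "(ys, xs) \<in> parcs (hypercube n)" if "(xs, ys) \<in> parcs (hypercube n)" for xs ys
      using that unfolding hypercube_def pair_pre_digraph.simps mem_Collect_eq case_prod_conv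
        comm[of xs ys] by blast
    then show ?thesis
      by (auto simp: symmetric_def sym_def)
  qed
  show ?thesis
  proof unfold_locales
    show "finite (pverts (hypercube n))"
      using fin by (simp add: hypercube_def)
    show "finite (parcs (hypercube n))"
      by (rule fin_arcs)
    show "symmetric (with_proj (hypercube n))"
      by (rule sym)
    fix e
    assume e: "e \<in> parcs (hypercube n)"
    obtain xs ys where e_eq: "e = (xs, ys)"
      by (cases e)
    have d: "length xs = n" "length ys = n" "card {i. i < n \<and> xs ! i \<noteq> ys ! i} = 1"
      using e unfolding e_eq hypercube_def pair_pre_digraph.simps mem_Collect_eq case_prod_conv
      by blast+
    then show "fst e \<in> pverts (hypercube n)" "snd e \<in> pverts (hypercube n)"
      by (simp_all add: e_eq hypercube_def)
    have "xs \<noteq> ys"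
    proof
      assume "xs = ys"
      then have "{i. i < n \<and> xs ! i \<noteq> ys ! i} = {}"
        by blast
      with d(3) show False
        by (metis card.empty zero_neq_one)
    qed
    then show "fst e \<noteq> snd e"
      by (simp add: e_eq)
  qed
qed

end

theory Submission
  imports Defs
begin

text \<open>
  The classes of words with the same syndrome, the exclusive or of the positions of
  the ones, are \<open>2\<close>-packings of \<open>Q\<^sub>n\<close>, because the words of a closed ball have
  distinct syndromes. If \<open>n < 2 ^ k\<close>, then there are at most \<open>2 ^ k\<close> classes, so one of them has at
  least \<open>2 ^ (n - k)\<close> words. The sphere-packing bound matches this for \<open>n = 2 ^ k - 1\<close>. In
  dimension \<open>4\<close>, three words at mutual distance at least \<open>3\<close> would form a triangle of perimeter
  more than \<open>8\<close>, and dimensions \<open>5\<close> and \<open>6\<close> follow because adding a coordinate at most doubles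
  the packing number.

  A \<open>2\<close>-packing of \<open>Q\<^sub>n\<close> times an edge is an open packing of \<open>Q\<^sub>n\<^sub>+\<^sub>1\<close>; conversely, deleting
  a coordinate maps the even and the odd words of an open packing to \<open>2\<close>-packings. Hence
  the open packing number of \<open>Q\<^sub>n\<^sub>+\<^sub>1\<close> is twice the packing number of \<open>Q\<^sub>n\<close>.
\<close>

section \<open>Neighbourhoods in the hypercube\<close>

abbreviation flip :: "bool list \<Rightarrow> nat \<Rightarrow> bool list" where
  "flip xs i \<equiv> xs[i := \<not> xs ! i]"

lemma pverts_hypercube [simp]: "pverts (hypercube n) = {xs. length xs = n}"
  by (simp add: hypercube_def)

lemma parcs_hypercube:
  "(xs, ys) \<in> parcs (hypercube n) \<longleftrightarrow>
     length xs = n \<and> length ys = n \<and> card {i. i < n \<and> xs ! i \<noteq> ys ! i} = 1"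
  by (simp add: hypercube_def)

lemma finite_pverts_hypercube: "finite (pverts (hypercube n))"
  using finite_lists_length_eq[of "UNIV :: bool set" n] by simp

lemma card_pverts_hypercube: "card {xs :: bool list. length xs = n} = 2 ^ n"
  using card_lists_length_eq[of "UNIV :: bool set" n] by simp

lemma finite_subset_hypercube: "X \<subseteq> {xs :: bool list. length xs = n} \<Longrightarrow> finite X"
  using finite_pverts_hypercube[of n] finite_subset by auto

lemma nbh_hypercube:
  assumes "length xs = n"
  shows "nbh (hypercube n) xs = flip xs ` {..<n}"
proof (intro equalityI subsetI)
  fix ys
  assume "ys \<in> nbh (hypercube n) xs"
  then have len: "length ys = n" and "card {i. i < n \<and> xs ! i \<noteq> ys ! i} = 1"
    by (simp_all add: nbh_def parcs_hypercube)
  then obtain i where i: "{i. i < n \<and> xs ! i \<noteq> ys ! i} = {i}"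
    using card_1_singletonE by blast
  then have "\<forall>j<n. (xs ! j \<noteq> ys ! j) = (j = i)"
    by blast
  then have "ys = flip xs i"
    using len assms by (intro nth_equalityI) (auto simp: nth_list_update)
  then show "ys \<in> flip xs ` {..<n}"
    using i by blast
next
  fix ys
  assume "ys \<in> flip xs ` {..<n}"
  then obtain i where i: "i < n" "ys = flip xs i"
    by blast
  then have "{j. j < n \<and> xs ! j \<noteq> ys ! j} = {i}"
    using assms by (auto simp: nth_list_update)
  then show "ys \<in> nbh (hypercube n) xs"
    using i assms by (simp add: nbh_def parcs_hypercube)
qed

lemma nbh_hypercube_sym:
  assumes "y \<in> nbh (hypercube n) x"
  shows "x \<in> nbh (hypercube n) y"
proof -
  have E: "{i. i < n \<and> y ! i \<noteq> x ! i} = {i. i < n \<and> x ! i \<noteq> y ! i}"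
    by blast
  show ?thesis
    using assms unfolding nbh_def parcs_hypercube pverts_hypercube mem_Collect_eq E by blast
qed

lemma closed_nbh_hypercube_sym:
  "y \<in> closed_nbh (hypercube n) x \<Longrightarrow> x \<in> closed_nbh (hypercube n) y"
  by (auto simp: closed_nbh_def nbh_hypercube_sym)

lemma nbh_hypercube_Cons:
  assumes "length xs = n"
  shows "nbh (hypercube (Suc n)) (b # xs) = insert ((\<not> b) # xs) ((#) b ` nbh (hypercube n) xs)"
  using assms by (simp add: nbh_hypercube lessThan_Suc_eq_insert_0 image_image)

lemma nbh_irrefl: "x \<notin> nbh (hypercube n) x"
  by (simp add: nbh_def parcs_hypercube)

lemma card_closed_nbh:
  assumes "length xs = n"
  shows "card (closed_nbh (hypercube n) xs) = Suc n"
proof -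
  have "inj_on (flip xs) {..<n}"
  proof (rule inj_onI)
    fix i j
    assume "i \<in> {..<n}" "j \<in> {..<n}" "flip xs i = flip xs j"
    then show "i = j"
      using assms by (metis lessThan_iff nth_list_update_eq nth_list_update_neq)
  qed
  then have "card (nbh (hypercube n) xs) = n"
    using assms by (simp add: nbh_hypercube card_image)
  moreover have "finite (nbh (hypercube n) xs)"
    using assms by (simp add: nbh_hypercube)
  ultimately show ?thesis
    using nbh_irrefl[of xs n] by (simp add: closed_nbh_def)
qed

lemma closed_nbh_subset:
  "length x = n \<Longrightarrow> closed_nbh (hypercube n) x \<subseteq> {xs. length xs = n}"
  by (auto simp: closed_nbh_def nbh_def)

section \<open>Packings of maximum size\<close>

lemma card_le_packing_number:
  "two_packing (hypercube n) X \<Longrightarrow> card X \<le> packing_number (hypercube n)"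
  unfolding packing_number_def
  using packing_cards[OF finite_pverts_hypercube[of n]] by (intro Max_ge) auto

lemma card_le_open_packing_number:
  "open_packing (hypercube n) X \<Longrightarrow> card X \<le> open_packing_number (hypercube n)"
  unfolding open_packing_number_def
  using packing_cards[OF finite_pverts_hypercube[of n]] by (intro Max_ge) auto

lemma packing_number_witness:
  obtains X where "two_packing (hypercube n) X" "card X = packing_number (hypercube n)"
proof -
  have "packing_number (hypercube n) \<in> {card X | X. two_packing (hypercube n) X}"
    unfolding packing_number_def
    using packing_cards[OF finite_pverts_hypercube[of n]] by (intro Max_in)
  then show ?thesis
    using that by auto
qed

lemma open_packing_number_witness:
  obtains X where "open_packing (hypercube n) X" "card X = open_packing_number (hypercube n)"
proof -
  have "open_packing_number (hypercube n) \<in> {card X | X. open_packing (hypercube n) X}"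
    unfolding open_packing_number_def
    using packing_cards[OF finite_pverts_hypercube[of n]] by (intro Max_in)
  then show ?thesis
    using that by auto
qed

section \<open>Upper bounds\<close>

text \<open>The closed neighbourhoods of a 2-packing are disjoint, and each takes up
  \<open>Suc n\<close> of the \<open>2 ^ n\<close> vertices.\<close>

lemma sphere_packing_bound: "packing_number (hypercube n) * Suc n \<le> 2 ^ n"
proof -
  obtain X where X: "two_packing (hypercube n) X" and card: "card X = packing_number (hypercube n)"
    by (rule packing_number_witness)
  let ?B = "closed_nbh (hypercube n)"
  have sub: "X \<subseteq> {xs. length xs = n}"
    using X by (simp add: two_packing_def)
  then have fin: "finite X"
    by (rule finite_subset_hypercube)
  have "card (\<Union>x\<in>X. ?B x) = (\<Sum>x\<in>X. card (?B x))"
  proof (rule card_UN_disjoint[OF fin])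
    show "\<forall>x\<in>X. finite (?B x)"
      using sub by (auto intro!: finite_subset_hypercube[OF closed_nbh_subset])
    show "\<forall>x\<in>X. \<forall>y\<in>X. x \<noteq> y \<longrightarrow> ?B x \<inter> ?B y = {}"
      using X by (simp add: two_packing_def)
  qed
  also have "\<dots> = card X * Suc n"
    using sub by (simp add: card_closed_nbh subset_iff)
  finally have "card X * Suc n = card (\<Union>x\<in>X. ?B x)"
    by simp
  also have "\<dots> \<le> card {xs :: bool list. length xs = n}"
    using sub closed_nbh_subset finite_subset_hypercube[OF subset_refl]
    by (intro card_mono UN_least) auto
  finally show ?thesis
    by (simp add: card card_pverts_hypercube)
qed

text \<open>The words of a packing with a fixed first letter \<open>b\<close> stay a 2-packing when
  \<open>b\<close> is deleted, since prefixing \<open>b\<close> embeds the smaller cube.\<close>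

lemma packing_number_Suc_le:
  "packing_number (hypercube (Suc n)) \<le> 2 * packing_number (hypercube n)"
proof -
  obtain X where X: "two_packing (hypercube (Suc n)) X"
    and card: "card X = packing_number (hypercube (Suc n))"
    by (rule packing_number_witness)
  define S where "S b = {xs. b # xs \<in> X}" for b
  have len: "length x = Suc n" if "x \<in> X" for x
    using X that by (auto simp: two_packing_def)
  have lenS: "length x = n" if "x \<in> S b" for x b
    using that len[of "b # x"] by (simp add: S_def)
  have bound: "card (S b) \<le> packing_number (hypercube n)" for b
  proof (rule card_le_packing_number)
    have "closed_nbh (hypercube n) x \<inter> closed_nbh (hypercube n) y = {}"
      if xy: "x \<in> S b" "y \<in> S b" "x \<noteq> y" for x y
    proof -
      have "closed_nbh (hypercube (Suc n)) (b # x) \<inter> closed_nbh (hypercube (Suc n)) (b # y) = {}"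
        using X xy by (auto simp: two_packing_def S_def)
      moreover have "length x = n" "length y = n"
        using xy lenS by blast+
      ultimately show ?thesis
        by (auto simp: closed_nbh_def nbh_hypercube_Cons)
    qed
    then show "two_packing (hypercube n) (S b)"
      using lenS by (auto simp: two_packing_def)
  qed
  have X_eq: "X = (#) True ` S True \<union> (#) False ` S False"
  proof (intro equalityI subsetI)
    fix x
    assume "x \<in> X"
    moreover from this obtain b xs where "x = b # xs"
      using len[of x] by (cases x) auto
    ultimately show "x \<in> (#) True ` S True \<union> (#) False ` S False"
      by (cases b) (auto simp: S_def)
  qed (auto simp: S_def)
  have "card X \<le> card (S True) + card (S False)"
    using card_Un_le[of "(#) True ` S True" "(#) False ` S False"]
    by (simp add: card_image flip: X_eq)
  then show ?thesis
    using bound[of True] bound[of False] card by linarith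
qed

section \<open>Hamming distance, and the bound in dimension 4\<close>

definition hdist :: "'a list \<Rightarrow> 'a list \<Rightarrow> nat" where
  "hdist xs ys = (\<Sum>i<length xs. of_bool (xs ! i \<noteq> ys ! i))"

lemma hdist_eq_card: "hdist xs ys = card {i. i < length xs \<and> xs ! i \<noteq> ys ! i}"
proof -
  have "{..<length xs} \<inter> {i. xs ! i \<noteq> ys ! i} = {i. i < length xs \<and> xs ! i \<noteq> ys ! i}"
    by auto
  then show ?thesis
    by (simp add: hdist_def sum.If_cases of_bool_def)
qed

lemma hdist_triangle:
  assumes "length xs = n" "length ys = n"
  shows "hdist xs zs \<le> hdist xs ys + hdist ys zs"
  \<comment> \<open>Coordinatewise: where \<open>xs\<close> and \<open>zs\<close> differ,
    \<open>ys\<close> differs from at least one of them.\<close>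
  unfolding hdist_def assms sum.distrib[symmetric] by (rule sum_mono) auto

lemma hdist_closed_nbh: "length x = n \<Longrightarrow> y \<in> closed_nbh (hypercube n) x \<Longrightarrow> hdist x y \<le> 1"
  by (auto simp: closed_nbh_def nbh_def parcs_hypercube hdist_eq_card)

text \<open>A vertex common to two closed neighbourhoods would join their centres by a walk of
  length at most 2.\<close>

lemma two_packingI:
  assumes "X \<subseteq> {xs. length xs = n}"
    and "\<And>x y. x \<in> X \<Longrightarrow> y \<in> X \<Longrightarrow> x \<noteq> y \<Longrightarrow> 3 \<le> hdist x y"
  shows "two_packing (hypercube n) X"
proof -
  have "closed_nbh (hypercube n) x \<inter> closed_nbh (hypercube n) y = {}"
    if xy: "x \<in> X" "y \<in> X" "x \<noteq> y" for x y
  proof (rule ccontr)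
    assume "\<not> ?thesis"
    then obtain z where z: "z \<in> closed_nbh (hypercube n) x" "z \<in> closed_nbh (hypercube n) y"
      by blast
    have len: "length x = n" "length y = n" "length z = n"
      using xy assms(1) z(1) closed_nbh_subset by blast+
    have "hdist x y \<le> hdist x z + hdist z y"
      using len hdist_triangle by metis
    moreover have "hdist x z \<le> 1" "hdist z y \<le> 1"
      using len z hdist_closed_nbh closed_nbh_hypercube_sym by metis+
    ultimately show False
      using assms(2)[OF xy] by linarith
  qed
  then show ?thesis
    using assms(1) by (simp add: two_packing_def)
qed

text \<open>If \<open>x\<close> and \<open>y\<close> differ in one or two coordinates, correcting
  one of them in \<open>x\<close> gives a vertex in both closed neighbourhoods.\<close>

lemma two_packing_hdist:
  assumes "two_packing (hypercube n) X" "x \<in> X" "y \<in> X" "x \<noteq> y"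
  shows "3 \<le> hdist x y"
proof (rule ccontr)
  assume "\<not> 3 \<le> hdist x y"
  then have small: "hdist x y \<le> 2"
    by simp
  have len: "length x = n" "length y = n"
    using assms by (auto simp: two_packing_def)
  have disj: "closed_nbh (hypercube n) x \<inter> closed_nbh (hypercube n) y = {}"
    using assms by (auto simp: two_packing_def)
  define D where "D = {i. i < n \<and> x ! i \<noteq> y ! i}"
  have D: "finite D" "card D \<le> 2"
    using small len by (simp_all add: D_def hdist_eq_card)
  have "D \<noteq> {}"
    using assms(4) len nth_equalityI[of x y] by (auto simp: D_def)
  then obtain i where i: "i \<in> D"
    by blast
  have "flip x i \<in> nbh (hypercube n) x"
    unfolding nbh_hypercube[OF len(1)] by (rule imageI) (use i in \<open>simp add: D_def\<close>)
  then have "flip x i \<in> closed_nbh (hypercube n) x"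
    by (simp add: closed_nbh_def)
  moreover have "flip x i \<in> closed_nbh (hypercube n) y"
  proof (cases "D = {i}")
    case True
    then have "\<forall>m<n. (x ! m \<noteq> y ! m) = (m = i)"
      unfolding D_def by blast
    then have "flip x i = y"
      using len by (intro nth_equalityI) (auto simp: nth_list_update)
    then show ?thesis
      by (simp add: closed_nbh_def)
  next
    case False
    then obtain j where j: "j \<in> D" "j \<noteq> i"
      using i by blast
    then have "{i, j} = D"
      using i D by (intro card_seteq) auto
    then have "\<forall>m<n. (x ! m \<noteq> y ! m) = (m = i \<or> m = j)"
      unfolding D_def by blast
    then have "flip x i = flip y j"
      using len j(2) by (intro nth_equalityI) (auto simp: nth_list_update)
    moreover have "j < n"
      using j by (simp add: D_def)
    then have "flip y j \<in> nbh (hypercube n) y"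
      unfolding nbh_hypercube[OF len(2)] by (intro imageI) simp
    ultimately show ?thesis
      by (simp add: closed_nbh_def)
  qed
  ultimately show False
    using disj by blast
qed

text \<open>Of three bits two agree, so each coordinate contributes at most 2 to the
  perimeter.\<close>

lemma hdist_perimeter_le:
  fixes x y z :: "bool list"
  assumes "length x = n" "length y = n"
  shows "hdist x y + hdist y z + hdist x z \<le> 2 * n"
proof -
  have "hdist x y + hdist y z + hdist x z \<le> (\<Sum>i<n. 2)"
    unfolding hdist_def assms sum.distrib[symmetric] by (rule sum_mono) auto
  then show ?thesis
    by simp
qed

lemma packing_number_4_le: "packing_number (hypercube 4) \<le> 2"
proof (rule ccontr)
  assume "\<not> ?thesis"
  moreover obtain X where X: "two_packing (hypercube 4) X"
    and "card X = packing_number (hypercube 4)"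
    by (rule packing_number_witness)
  ultimately have "3 \<le> card X"
    by simp
  then obtain T where "T \<subseteq> X" "card T = 3"
    by (rule obtain_subset_with_card_n)
  then obtain x y z where xyz: "x \<in> X" "y \<in> X" "z \<in> X" "x \<noteq> y" "y \<noteq> z" "x \<noteq> z"
    by (auto simp: card_3_iff)
  then have "length x = 4" "length y = 4"
    using X by (auto simp: two_packing_def)
  then have "hdist x y + hdist y z + hdist x z \<le> 2 * 4"
    by (rule hdist_perimeter_le)
  then show False
    using two_packing_hdist[OF X xyz(1,2,4)] two_packing_hdist[OF X xyz(2,3,5)]
      two_packing_hdist[OF X xyz(1,3,6)] by linarith
qed

section \<open>Syndromes\<close>

unbundle bit_operations_syntax

text \<open>The first letter of the word has position \<open>m\<close>.\<close>

fun syndrome :: "nat \<Rightarrow> bool list \<Rightarrow> nat" where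
  "syndrome m [] = 0"
| "syndrome m (b # xs) = of_bool b * m XOR syndrome (Suc m) xs"

lemma xor_nat_left_cancel: "(a::nat) XOR (a XOR b) = b"
  by (simp flip: xor.assoc)

text \<open>A letter contributes its position or 0, so negating it toggles that position in the
  XOR.\<close>

lemma syndrome_flip: "i < length xs \<Longrightarrow> syndrome m (flip xs i) = syndrome m xs XOR (m + i)"
proof (induction m xs arbitrary: i rule: syndrome.induct)
  case (2 m b xs)
  then show ?case
    by (cases i; cases b) (simp_all add: 2 xor_nat_left_cancel xor.assoc xor.commute xor.left_commute)
qed simp

text \<open>Being below \<open>2 ^ k\<close> means being fixed by \<open>take_bit k\<close>, which
  distributes over XOR.\<close>

lemma xor_nat_less: "(a::nat) < 2 ^ k \<Longrightarrow> b < 2 ^ k \<Longrightarrow> a XOR b < 2 ^ k"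
  by (simp add: flip: take_bit_nat_eq_self_iff)

lemma syndrome_less: "m + length xs \<le> 2 ^ k \<Longrightarrow> syndrome m xs < 2 ^ k"
  by (induction m xs rule: syndrome.induct) (auto intro!: xor_nat_less)

text \<open>Changing the bit at position \<open>i\<close> XORs the syndrome of the centre with
  \<open>i\<close>, and XOR with a fixed number is injective.\<close>

lemma inj_on_syndrome_closed_nbh:
  assumes "length z = n"
  shows "inj_on (syndrome 1) (closed_nbh (hypercube n) z)"
proof (rule inj_onI)
  \<comment> \<open>Index 0 encodes the centre, \<open>i > 0\<close> the flip at list index
    \<open>i - 1\<close>. Positions start at 1 to keep 0 free for the centre.\<close>
  have *: "\<exists>i. syndrome 1 x = syndrome 1 z XOR i \<and> x = (if i = 0 then z else flip z (i - 1))"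
    if x: "x \<in> closed_nbh (hypercube n) z" for x
  proof (cases "x = z")
    case True
    then show ?thesis
      by (intro exI[of _ 0]) simp
  next
    case False
    then obtain j where j: "j < n" "x = flip z j"
      using x assms by (auto simp: closed_nbh_def nbh_hypercube)
    then show ?thesis
      using assms syndrome_flip[of j z 1] by (intro exI[of _ "Suc j"]) simp
  qed
  fix x y
  assume "x \<in> closed_nbh (hypercube n) z" "y \<in> closed_nbh (hypercube n) z"
    and eq: "syndrome 1 x = syndrome 1 y"
  from *[OF this(1)] *[OF this(2)] obtain i j where
    i: "syndrome 1 x = syndrome 1 z XOR i" "x = (if i = 0 then z else flip z (i - 1))" and
    j: "syndrome 1 y = syndrome 1 z XOR j" "y = (if j = 0 then z else flip z (j - 1))"
    by blast
  from eq i(1) j(1) have "i = j"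
    by (metis xor.left_neutral xor_self_eq xor.assoc)
  with i(2) j(2) show "x = y"
    by simp
qed

text \<open>Two words of a class whose closed neighbourhoods share \<open>z\<close> both lie in the
  ball around \<open>z\<close>, where the syndrome is injective.\<close>

lemma two_packing_syndrome_class:
  "two_packing (hypercube n) {xs. length xs = n \<and> syndrome 1 xs = s}"
proof -
  have "x = y" if "length x = n" "length y = n" "syndrome 1 x = syndrome 1 y"
    "z \<in> closed_nbh (hypercube n) x" "z \<in> closed_nbh (hypercube n) y" for x y z
  proof -
    have "length z = n"
      using that closed_nbh_subset by blast
    then show ?thesis
      using inj_on_syndrome_closed_nbh[of z n] that closed_nbh_hypercube_sym[of z n]
      by (meson inj_onD)
  qed
  then show ?thesis
    by (fastforce simp: two_packing_def)
qed

text \<open>The \<open>2 ^ n\<close> words fall into at most \<open>2 ^ k\<close> syndrome classes,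
  none larger than the packing number.\<close>

lemma packing_number_ge:
  assumes "n < 2 ^ k"
  shows "2 ^ (n - k) \<le> packing_number (hypercube n)"
proof -
  let ?C = "\<lambda>s. {xs. length xs = n \<and> syndrome 1 xs = s}"
  have "{xs :: bool list. length xs = n} \<subseteq> (\<Union>s<2 ^ k. ?C s)"
    using assms syndrome_less[of 1 _ k] by auto
  then have "card {xs :: bool list. length xs = n} \<le> card (\<Union>s<2 ^ k. ?C s)"
    by (intro card_mono finite_UN_I) (auto intro: finite_subset_hypercube)
  also have "\<dots> \<le> (\<Sum>s<(2::nat) ^ k. card (?C s))"
    by (rule card_UN_le) simp
  also have "\<dots> \<le> (\<Sum>s<(2::nat) ^ k. packing_number (hypercube n))"
    by (intro sum_mono card_le_packing_number two_packing_syndrome_class)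
  finally have "2 ^ n \<le> 2 ^ k * packing_number (hypercube n)"
    by (simp add: card_pverts_hypercube)
  moreover have "(2::nat) ^ n \<ge> 2 ^ k * 2 ^ (n - k)" if "k \<le> n"
    using that by (simp flip: power_add)
  ultimately have "2 ^ k * 2 ^ (n - k) \<le> 2 ^ k * packing_number (hypercube n)" if "k \<le> n"
    using that order_trans by blast
  \<comment> \<open>For \<open>n < k\<close> the truncated exponent \<open>n - k\<close> is 0, and
    positivity is all that remains to show.\<close>
  moreover have "packing_number (hypercube n) \<noteq> 0"
    using \<open>2 ^ n \<le> 2 ^ k * packing_number (hypercube n)\<close> by (intro notI) simp
  ultimately show ?thesis
    by (cases "k \<le> n") auto
qed

text \<open>Here \<open>j\<close> is the floor of the binary logarithm of \<open>n\<close>, and the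
  lower bound is \<open>packing_number_ge\<close> with \<open>k = Suc j\<close>. The range starts at
  1 because part (b) for dimension 2 reduces to dimension 1.\<close>

lemma packing_number_hypercube:
  assumes "(1 \<le> n \<and> n \<le> 7) \<or> (\<exists>k\<ge>1. n = 2 ^ k - 1)"
  obtains j where "2 ^ j \<le> n" "n < 2 ^ Suc j" "packing_number (hypercube n) = 2 ^ (n - Suc j)"
proof -
  have perfect: "packing_number (hypercube n) \<le> 2 ^ (n - k)" if "n = 2 ^ k - 1" for n k
  proof -
    have "Suc n = 2 ^ k"
      using that by simp
    then have "packing_number (hypercube n) * 2 ^ k \<le> 2 ^ n"
      using sphere_packing_bound[of n] by simp
    also have "k \<le> n"
      using that less_exp[of k] by linarith
    then have "(2::nat) ^ n = 2 ^ (n - k) * 2 ^ k"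
      by (simp flip: power_add)
    finally show ?thesis
      by simp
  qed
  have p2: "packing_number (hypercube 2) \<le> 1"
    using sphere_packing_bound[of 2] by simp
  \<comment> \<open>The sphere-packing bound alone would allow 5 and 9 words, so the bound 2 of
    dimension 4 is doubled instead.\<close>
  have p5: "packing_number (hypercube 5) \<le> 4" and p6: "packing_number (hypercube 6) \<le> 8"
    using packing_number_Suc_le[of 4] packing_number_Suc_le[of 5] packing_number_4_le by simp_all
  have "\<exists>j. 2 ^ j \<le> n \<and> n < 2 ^ Suc j \<and> packing_number (hypercube n) \<le> 2 ^ (n - Suc j)"
  proof (cases "\<exists>k\<ge>1. n = 2 ^ k - 1")
    case True
    then obtain j where j: "n = 2 ^ Suc j - 1"
      by (metis Suc_le_D One_nat_def)
    have "(1::nat) \<le> 2 ^ j"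
      by simp
    with j have "2 ^ j \<le> n" "n < 2 ^ Suc j"
      by simp_all
    with perfect[OF j] show ?thesis
      by blast
  next
    case False
    \<comment> \<open>Ruling out the perfect lengths up to 7 leaves 2, 4, 5 and 6.\<close>
    have "n \<noteq> 2 ^ 1 - 1" "n \<noteq> 2 ^ 2 - 1" "n \<noteq> 2 ^ 3 - 1"
      using False one_le_numeral by blast+
    then have "n \<noteq> 1" "n \<noteq> 3" "n \<noteq> 7"
      by simp_all
    with assms False have "n = 2 \<or> n = 4 \<or> n = 5 \<or> n = 6"
      by auto
    then show ?thesis
      using p2 packing_number_4_le p5 p6
      by (elim disjE; intro exI[of _ "if n = 2 then 1 else 2"]) simp_all
  qed
  then show ?thesis
    using that packing_number_ge[of n] by (meson le_antisym)
qed

section \<open>Open packings\<close>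

fun parity :: "bool list \<Rightarrow> bool" where
  "parity [] = False"
| "parity (b # xs) = (b \<noteq> parity xs)"

lemma parity_flip: "i < length xs \<Longrightarrow> parity (flip xs i) = (\<not> parity xs)"
  by (induction xs arbitrary: i) (auto simp: nth_Cons split: nat.splits)

lemma parity_nbh: "length x = n \<Longrightarrow> y \<in> nbh (hypercube n) x \<Longrightarrow> parity y = (\<not> parity x)"
  by (auto simp: nbh_hypercube parity_flip)

text \<open>Deleting the first letter sends a neighbour of \<open>b # x\<close> into the closed
  neighbourhood of \<open>x\<close>, so a common neighbour forces \<open>x = y\<close>. The two ends
  of an edge have no common neighbour.\<close>

lemma open_packing_prism:
  assumes "two_packing (hypercube n) X"
  shows "open_packing (hypercube (Suc n)) ((#) True ` X \<union> (#) False ` X)"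
proof -
  have len: "length x = n" if "x \<in> X" for x
    using assms that by (auto simp: two_packing_def)
  have "b = c \<and> x = y"
    if xy: "x \<in> X" "y \<in> X" and z: "z \<in> nbh (hypercube (Suc n)) (b # x)"
      "z \<in> nbh (hypercube (Suc n)) (c # y)" for b c x y z
  proof -
    have "tl z \<in> closed_nbh (hypercube n) x" "tl z \<in> closed_nbh (hypercube n) y"
      using xy z len by (auto simp: nbh_hypercube_Cons closed_nbh_def)
    then have "x = y"
      using xy assms by (auto simp: two_packing_def)
    then show ?thesis
      using xy z len nbh_irrefl by (auto simp: nbh_hypercube_Cons)
  qed
  then show ?thesis
    using len by (fastforce simp: open_packing_def)
qed

text \<open>Equal parity lets the rest of a word determine its first letter, so a common vertex
  \<open>w\<close> of two punctured closed neighbourhoods lifts to a common neighbour of the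
  original words.\<close>

lemma open_packing_puncture:
  assumes Y: "open_packing (hypercube (Suc n)) Y" and par: "\<And>y. y \<in> Y \<Longrightarrow> parity y = p"
  shows "card Y \<le> packing_number (hypercube n)"
proof -
  have common: "b # u = c # v"
    if mem: "b # u \<in> Y" "c # v \<in> Y"
      and w: "w \<in> closed_nbh (hypercube n) u" "w \<in> closed_nbh (hypercube n) v" for b c u v w
  proof -
    have len: "length u = n" "length v = n"
      using Y mem by (auto simp: open_packing_def)
    have same: "(b \<noteq> parity u) = (c \<noteq> parity v)"
      using par[OF mem(1)] par[OF mem(2)] by simp
    have disj: "\<forall>x\<in>Y. \<forall>y\<in>Y. x \<noteq> y \<longrightarrow>
        nbh (hypercube (Suc n)) x \<inter> nbh (hypercube (Suc n)) y = {}"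
      using Y by (simp add: open_packing_def)
    have inter: "b # u = c # v"
      if "z \<in> nbh (hypercube (Suc n)) (b # u)" "z \<in> nbh (hypercube (Suc n)) (c # v)" for z
      using disj[rule_format, OF mem] that by blast
    \<comment> \<open>Parity alternates along edges: if \<open>u\<close> and \<open>v\<close> are
      adjacent, the first letters differ and the lift completes a 4-cycle; if \<open>w\<close> is
      adjacent to both, the first letters agree and the lift is \<open>b # w\<close>.\<close>
    consider "u = v" | "w = u" "u \<in> nbh (hypercube n) v" | "w = v" "v \<in> nbh (hypercube n) u"
      | "w \<in> nbh (hypercube n) u" "w \<in> nbh (hypercube n) v"
      using w by (auto simp: closed_nbh_def)
    then show ?thesis
    proof cases
      case 1
      then show ?thesis
        using same by auto
    next
      case 2
      then have "c = (\<not> b)"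
        using same parity_nbh[of v n u] len by auto
      then show ?thesis
        using 2 len inter[of "(\<not> b) # u"] by (simp add: nbh_hypercube_Cons)
    next
      case 3
      then have "c = (\<not> b)"
        using same parity_nbh[of u n v] len by auto
      then show ?thesis
        using 3 len inter[of "b # v"] by (simp add: nbh_hypercube_Cons)
    next
      case 4
      then have "b = c"
        using same parity_nbh[of u n w] parity_nbh[of v n w] len by auto
      then show ?thesis
        using 4 len inter[of "b # w"] by (simp add: nbh_hypercube_Cons)
    qed
  qed
  have ex: "\<exists>b u. y = b # u \<and> length u = n" if "y \<in> Y" for y
    using Y that by (cases y) (auto simp: open_packing_def)
  have "inj_on tl Y"
  proof (rule inj_onI)
    fix x y
    assume xy: "x \<in> Y" "y \<in> Y" "tl x = tl y"
    then obtain b c u where "x = b # u" "y = c # u"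
      using ex by (metis list.sel(3))
    then show "x = y"
      using common[of b u c u u] xy by (simp add: closed_nbh_def)
  qed
  moreover have "two_packing (hypercube n) (tl ` Y)"
    unfolding two_packing_def
  proof (intro conjI ballI impI)
    show "tl ` Y \<subseteq> pverts (hypercube n)"
      using ex by fastforce
    fix x y
    assume "x \<in> tl ` Y" "y \<in> tl ` Y" "x \<noteq> y"
    moreover from this obtain b c where "b # x \<in> Y" "c # y \<in> Y"
      using ex by fastforce
    ultimately show "closed_nbh (hypercube n) x \<inter> closed_nbh (hypercube n) y = {}"
      using common[of b x c y] by blast
  qed
  ultimately show ?thesis
    using card_le_packing_number card_image by metis
qed

theorem open_packing_number_Suc:
  "open_packing_number (hypercube (Suc n)) = 2 * packing_number (hypercube n)"
proof (rule antisym)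
  obtain Y where Y: "open_packing (hypercube (Suc n)) Y"
    and card: "card Y = open_packing_number (hypercube (Suc n))"
    by (rule open_packing_number_witness)
  have "card {y \<in> Y. parity y = p} \<le> packing_number (hypercube n)" for p
    using Y by (intro open_packing_puncture[where p = p]) (auto simp: open_packing_def)
  from this[of True] this[of False]
  have "card {y \<in> Y. parity y} + card {y \<in> Y. \<not> parity y} \<le> 2 * packing_number (hypercube n)"
    by simp
  moreover have "Y = {y \<in> Y. parity y} \<union> {y \<in> Y. \<not> parity y}"
    by auto
  then have "card Y \<le> card {y \<in> Y. parity y} + card {y \<in> Y. \<not> parity y}"
    using card_Un_le by metis
  ultimately show "open_packing_number (hypercube (Suc n)) \<le> 2 * packing_number (hypercube n)"
    using card by simp
next
  obtain X where X: "two_packing (hypercube n) X" and card: "card X = packing_number (hypercube n)"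
    by (rule packing_number_witness)
  have "finite X"
    using X finite_subset_hypercube by (auto simp: two_packing_def)
  then have "card ((#) True ` X \<union> (#) False ` X) = card X + card X"
    by (subst card_Un_disjoint) (auto simp: card_image)
  then show "2 * packing_number (hypercube n) \<le> open_packing_number (hypercube (Suc n))"
    using card_le_open_packing_number[OF open_packing_prism[OF X]] card by simp
qed

section \<open>A code of length \<open>8\<close> with \<open>17\<close> words\<close>

text \<open>Comparing each pair only once keeps the evaluation small. Distinctness follows because
  equal words have distance 0, and it makes the list length the cardinality.\<close>

lemma two_packing_of_list:
  assumes "sorted_wrt (\<lambda>x y. 3 \<le> hdist x y) xss" "\<forall>xs \<in> set xss. length xs = n"
  shows "two_packing (hypercube n) (set xss)" and "distinct xss"
proof -
  have hdist_commute: "hdist x y = hdist y x" if "x \<in> set xss" "y \<in> set xss" for x y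
    unfolding hdist_def using assms(2) that by (intro sum.cong) auto
  have far: "3 \<le> hdist (xss ! i) (xss ! j)" if "i < j" "j < length xss" for i j
    using sorted_wrt_nth_less[OF assms(1) that] .
  show "two_packing (hypercube n) (set xss)"
  proof (rule two_packingI)
    fix x y
    assume xy: "x \<in> set xss" "y \<in> set xss" "x \<noteq> y"
    then obtain i j where "i < length xss" "x = xss ! i" "j < length xss" "y = xss ! j"
      by (metis in_set_conv_nth)
    then show "3 \<le> hdist x y"
      using far[of i j] far[of j i] hdist_commute xy by (cases i j rule: linorder_cases) auto
  qed (use assms(2) in auto)
  show "distinct xss"
    unfolding distinct_conv_nth
  proof (intro allI impI)
    fix i j
    assume "i < length xss" "j < length xss" "i \<noteq> j"
    then show "xss ! i \<noteq> xss ! j"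
      using far[of i j] far[of j i] by (cases i j rule: linorder_cases) (auto simp: hdist_def)
  qed
qed

text \<open>The word of a number consists of its eight lowest bits.
  The numbers were found by computer search.\<close>

definition code8 :: "bool list list" where
  "code8 = map (\<lambda>w::nat. map (bit w) [0..<8])
     [0, 13, 30, 38, 43, 53, 71, 81, 114, 124, 138, 147, 176, 191, 204, 214, 225]"

lemma packing_number_8_ge: "17 \<le> packing_number (hypercube 8)"
proof -
  have "sorted_wrt (\<lambda>x y. 3 \<le> hdist x y) code8"
    by code_simp
  moreover have "\<forall>xs \<in> set code8. length xs = 8"
    by (simp add: code8_def)
  ultimately have "two_packing (hypercube 8) (set code8)" "distinct code8"
    by (rule two_packing_of_list)+
  moreover have "length code8 = 17"
    by (simp add: code8_def)
  ultimately show ?thesis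
    using card_le_packing_number distinct_card by metis
qed

section \<open>Powers of two with integer exponents\<close>

lemma two_powi_floor_log:
  assumes "2 ^ j \<le> n" "n < 2 ^ Suc j"
  shows "2 powi (int n - \<lfloor>log 2 (real n)\<rfloor> - 1) = (2::real) ^ (n - Suc j)"
proof -
  have "\<lfloor>log 2 (real n)\<rfloor> = int j"
    using floor_log_nat_eq_if[of 2 j n] assms by simp
  \<comment> \<open>This makes the natural subtraction \<open>n - Suc j\<close> agree with the
    integer one.\<close>
  moreover have "j < n"
    using less_exp[of j] assms(1) by linarith
  then have "int n - int j - 1 = int (n - Suc j)"
    by simp
  ultimately show ?thesis
    by (simp only: power_int_of_nat)
qed

lemma packing_number_hypercube_powi:
  assumes "(1 \<le> n \<and> n \<le> 7) \<or> (\<exists>k\<ge>1. n = 2 ^ k - 1)"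
  shows "real (packing_number (hypercube n)) = 2 powi (int n - \<lfloor>log 2 (real n)\<rfloor> - 1)"
  using packing_number_hypercube[OF assms] two_powi_floor_log
  by (metis of_nat_numeral of_nat_power)

theorem mainTheorem6:
  shows "(\<forall>n::nat. (2 \<le> n \<and> n \<le> 7) \<or> (\<exists>k::nat. k \<ge> 2 \<and> n = 2 ^ k - 1) \<longrightarrow>
            real (packing_number (hypercube n))
              = 2 powi (int n - \<lfloor>log 2 (real n)\<rfloor> - 1)) \<and>
         (\<forall>n::nat. (2 \<le> n \<and> n \<le> 8) \<or> (\<exists>k::nat. k \<ge> 1 \<and> n = 2 ^ k) \<longrightarrow>
            real (open_packing_number (hypercube n))
              = 2 powi (int n - \<lfloor>log 2 (real n - 1)\<rfloor> - 1)) \<and>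
         packing_number (hypercube 8) \<ge> 17 \<and>
         open_packing_number (hypercube 9) \<ge> 34 \<and>
         real (packing_number (hypercube 8))
           \<noteq> 2 powi (int 8 - \<lfloor>log 2 (real 8)\<rfloor> - 1) \<and>
         real (open_packing_number (hypercube 9))
           \<noteq> 2 powi (int 9 - \<lfloor>log 2 (real 9 - 1)\<rfloor> - 1)"
proof -
  have a: "real (packing_number (hypercube n)) = 2 powi (int n - \<lfloor>log 2 (real n)\<rfloor> - 1)"
    if "(2 \<le> n \<and> n \<le> 7) \<or> (\<exists>k::nat. k \<ge> 2 \<and> n = 2 ^ k - 1)" for n
  proof (rule packing_number_hypercube_powi)
    show "(1 \<le> n \<and> n \<le> 7) \<or> (\<exists>k\<ge>1. n = 2 ^ k - 1)"
      using that by (metis one_le_numeral order_trans)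
  qed
  have b: "real (open_packing_number (hypercube n)) = 2 powi (int n - \<lfloor>log 2 (real n - 1)\<rfloor> - 1)"
    if n: "(2 \<le> n \<and> n \<le> 8) \<or> (\<exists>k::nat. k \<ge> 1 \<and> n = 2 ^ k)" for n
  proof -
    have "2 \<le> n"
      using n self_le_power[of "2::nat"] by auto
    then obtain m where m: "n = Suc m"
      by (cases n) auto
    have "(1 \<le> m \<and> m \<le> 7) \<or> (\<exists>k\<ge>1. m = 2 ^ k - 1)"
      using n
    proof
      assume "\<exists>k\<ge>1. n = 2 ^ k"
      then show ?thesis
        using m by (metis diff_Suc_1)
    qed (simp add: m)
    then have "real (packing_number (hypercube m)) = 2 powi (int m - \<lfloor>log 2 (real m)\<rfloor> - 1)"
      by (rule packing_number_hypercube_powi)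
    \<comment> \<open>The logarithms coincide, as \<open>n - 1 = m\<close>, and the extra 1 in the
      exponent is the factor 2 of \<open>open_packing_number_Suc\<close>.\<close>
    moreover have "int n - \<lfloor>log 2 (real n - 1)\<rfloor> - 1 = (int m - \<lfloor>log 2 (real m)\<rfloor> - 1) + 1"
      by (simp add: m)
    ultimately show ?thesis
      using power_int_add_1'[of "2::real" "int m - \<lfloor>log 2 (real m)\<rfloor> - 1"]
      by (simp add: m open_packing_number_Suc)
  qed
  have c: "34 \<le> open_packing_number (hypercube 9)"
    using open_packing_number_Suc[of 8] packing_number_8_ge by simp
  \<comment> \<open>With this value the formulas would give 16 and 32, below the bounds 17 and
    34.\<close>
  have log8: "\<lfloor>log 2 8 :: real\<rfloor> = 3"
    using floor_log_nat_eq_if[of 2 3 8] by simp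
  show ?thesis
    using a b c packing_number_8_ge by (auto simp: log8)
qed

end
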